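(* For every $n$ there is a carefully synchronizing PFA on $n$ states and two symbols with shortest carefully synchronizing word length $\Omega(\phi^{n/5})$, where $\phi = \frac{1+\sqrt5}{2}$. That is, there are a constant $c>0$ and an integer $N$ such that for every integer $n\ge N$ there is a carefully synchronizing PFA with exactly $n$ states and an alphabet of two symbols, all of whose carefully synchronizing words have length at least $c\,\phi^{n/5}$.
   Context: A partial finite automaton (PFA) over a finite alphabet $\Sigma$ consists of a finite set $Q$ of states and a partial map $\delta : Q\times\Sigma \to Q$. For $q\in Q$, $w\in\Sigma^*$, $a\in\Sigma$ define $q\lambda = q$ for the empty word $\lambda$, and $q(wa) = \delta(qw,a)$, which is defined only if $qw$ is defined and $\delta(qw,a)$ is defined. A word $w\in\Sigma^*$ is carefully synchronizing if there is a state $q_s\in Q$ such that $qw$ is defined and $qw = q_s$ for all $q \in Q$. A PFA is carefully synchronizing if it admits a carefully synchronizing word. *)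

theory Defs
  imports Complex_Main
begin

text \<open>A partial transition map is a function into the option type, with \<open>None\<close>
  standing for ``undefined''. Its values outside \<open>states \<times> alphabet\<close> are irrelevant.\<close>

record ('q, 'a) pfa =
  states :: "'q set"
  alphabet :: "'a set"
  trans :: "'q \<Rightarrow> 'a \<Rightarrow> 'q option"

definition is_pfa :: "('q, 'a) pfa \<Rightarrow> bool" where
  "is_pfa A \<longleftrightarrow> finite (states A) \<and> finite (alphabet A) \<and>
     (\<forall>q \<in> states A. \<forall>a \<in> alphabet A. \<forall>p. trans A q a = Some p \<longrightarrow> p \<in> states A)"

definition run :: "('q, 'a) pfa \<Rightarrow> 'q \<Rightarrow> 'a list \<Rightarrow> 'q option" where
  "run A q w = foldl (\<lambda>r a. Option.bind r (\<lambda>p. trans A p a)) (Some q) w"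

lemma run_Nil: "run A q [] = Some q"
  by (simp add: run_def)

lemma run_snoc: "run A q (w @ [a]) = Option.bind (run A q w) (\<lambda>p. trans A p a)"
  by (simp add: run_def)

definition carefully_synchronizing_word :: "('q, 'a) pfa \<Rightarrow> 'a list \<Rightarrow> bool" where
  "carefully_synchronizing_word A w \<longleftrightarrow> w \<in> lists (alphabet A) \<and>
     (\<exists>s \<in> states A. \<forall>q \<in> states A. run A q w = Some s)"

definition carefully_synchronizing :: "('q, 'a) pfa \<Rightarrow> bool" where
  "carefully_synchronizing A \<longleftrightarrow> (\<exists>w. carefully_synchronizing_word A w)"

definition golden_ratio :: real where
  "golden_ratio = (1 + sqrt 5) / 2"

end

theory Submission
  imports Defs
begin

text \<open>The automaton simulates a binary counter of \<open>m\<close> bits, and it can only be synchronized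
  by counting up to \<open>2 ^ m\<close>. A carefully synchronizing word synchronizes every set of states, so for a
  lower bound it suffices to exhibit one bad set: the configuration of the counter that stands
  for zero.

  Suppose first that there may be six letters. A configuration is a set of states (``tokens''):
  a carry bit, a clock \<open>l \<le> m\<close>, and \<open>m + 1\<close> cells that hold one bit each and that move by
  one place around a cycle with each letter. A token cannot see the others, but a
  letter is usable only if it is defined on all of them, so each letter can be
  made to insist on a certain carry, on a certain bit in the cell at place \<open>0\<close>, and on the
  clock being at \<open>m\<close>. This is enough to add one to the counter: at clock \<open>m\<close> the carry is set, and
  then it ripples through the bits as they pass place \<open>0\<close>. The number
  \<open>\<Sum>j<m. g j * 2 ^ j + c * 2 ^ l\<close> grows by at most one per letter (\<open>potential_step\<close>), and the only
  letter that merges tokens of a configuration requires the carry to be set at clock \<open>m\<close>, hence a potential of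
  at least \<open>2 ^ m\<close>. Conversely a letter that is defined on all states brings the full
  state set to the zero configuration (\<open>run_reset\<close>), from where one can count and
  then merge (\<open>config_synchronizable\<close>).

  Two letters are enough if letter number \<open>i\<close> is written as \<open>i\<close> zeros followed by a one. Every
  token must then count zeros, but only as far as it needs to tell letters apart. A
  cell away from place \<open>0\<close> treats all letters alike and needs no counting; the clock away from
  \<open>m\<close> only refuses the first two letters and counts to \<open>2\<close>. So there are \<open>5 * m + O(1)\<close> states,
  and \<open>2 ^ m \<ge> golden_ratio ^ m\<close> gives the bound. Letting the clock at \<open>m\<close>
  count further than necessary adds single states, which realises every number \<open>n\<close>.\<close>

section \<open>Runs and renaming of states\<close>

lemma run_Cons: "run A q (a # w) = Option.bind (trans A q a) (\<lambda>p. run A p w)"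
proof -
  have none: "foldl (\<lambda>r a. Option.bind r (\<lambda>p. trans A p a)) None u = None" for u
    by (induction u) auto
  show ?thesis
    by (cases "trans A q a") (simp_all add: run_def none)
qed

lemma run_append: "run A q (u @ w) = Option.bind (run A q u) (\<lambda>p. run A p w)"
  by (induction u arbitrary: q) (simp_all add: run_Nil run_Cons)

definition rename :: "('q \<Rightarrow> 'r) \<Rightarrow> ('q, 'a) pfa \<Rightarrow> ('r, 'a) pfa" where
  "rename f A = \<lparr>states = f ` states A, alphabet = alphabet A,
     trans = \<lambda>r a. map_option f (trans A (inv_into (states A) f r) a)\<rparr>"

context
  fixes f :: "'q \<Rightarrow> 'r" and A :: "('q, 'a) pfa"
  assumes A: "is_pfa A" and inj: "inj_on f (states A)"
begin

lemma is_pfa_rename: "is_pfa (rename f A)"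
  using A inj by (auto simp: is_pfa_def rename_def)

lemma run_rename:
  assumes "q \<in> states A" "w \<in> lists (alphabet A)"
  shows "run (rename f A) (f q) w = map_option f (run A q w)"
  using assms
proof (induction w arbitrary: q)
  case (Cons a w)
  have "trans (rename f A) (f q) a = map_option f (trans A q a)"
    using Cons.prems inj by (simp add: rename_def)
  moreover have "p \<in> states A" if "trans A q a = Some p" for p
    using A Cons.prems that by (auto simp: is_pfa_def)
  ultimately show ?case
    using Cons by (cases "trans A q a") (auto simp: run_Cons)
qed (simp add: run_Nil)

lemma run_in_states:
  assumes "q \<in> states A" "w \<in> lists (alphabet A)" "run A q w = Some p"
  shows "p \<in> states A"
  using assms
proof (induction w arbitrary: q)
  case (Cons a w)
  then obtain r where r: "trans A q a = Some r" "run A r w = Some p"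
    by (auto simp: run_Cons bind_eq_Some_conv)
  then have "r \<in> states A"
    using A Cons.prems by (auto simp: is_pfa_def)
  then show ?case
    using Cons r(2) by auto
qed (simp add: run_Nil)

lemma carefully_synchronizing_word_rename:
  "carefully_synchronizing_word (rename f A) w \<longleftrightarrow> carefully_synchronizing_word A w"
proof (cases "w \<in> lists (alphabet A)")
  case True
  have "run (rename f A) (f q) w = Some (f s) \<longleftrightarrow> run A q w = Some s"
    if "q \<in> states A" "s \<in> states A" for q s
    using inj that True run_in_states by (auto simp: run_rename dest: inj_onD)
  then show ?thesis
    by (auto simp: carefully_synchronizing_word_def rename_def)
qed (auto simp: carefully_synchronizing_word_def rename_def)

end

section \<open>Writing many letters with two\<close>

text \<open>Letter \<open>i\<close> of \<open>A\<close> becomes the word \<open>0\<^sup>i 1\<close>. A state remembers how many zeros it has read, up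
  to \<open>cap t\<close>; this loses nothing if \<open>t\<close> treats all letters from \<open>cap t\<close> on alike. A cap that depends
  on the state keeps the number of states low.\<close>

definition unary_code :: "('q \<Rightarrow> nat) \<Rightarrow> ('q, nat) pfa \<Rightarrow> ('q \<times> nat, nat) pfa" where
  "unary_code cap A = \<lparr>states = (SIGMA t:states A. {..cap t}), alphabet = {0, 1},
     trans = \<lambda>(t, i) x. if x = 0 then Some (t, min (Suc i) (cap t))
                        else map_option (\<lambda>u. (u, 0)) (trans A t i)\<rparr>"

lemma trans_unary_code [simp]:
  "trans (unary_code cap A) (t, i) 0 = Some (t, min (Suc i) (cap t))"
  "x \<noteq> 0 \<Longrightarrow>
     trans (unary_code cap A) (t, i) x = map_option (\<lambda>u. (u, 0)) (trans A t i)"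
  by (simp_all add: unary_code_def)

lemma run_unary_code_pending:
  "run (unary_code cap A) (t, i) (replicate k 0 @ w) =
     run (unary_code cap A) (t, if k = 0 then i else min (i + k) (cap t)) w"
proof (induction k arbitrary: i)
  case (Suc k)
  have eq: "(if k = 0 then min (Suc i) (cap t) else min (min (Suc i) (cap t) + k) (cap t)) =
      min (i + Suc k) (cap t)"
    by auto
  have "run (unary_code cap A) (t, i) (replicate (Suc k) 0 @ w) =
      run (unary_code cap A) (t, min (Suc i) (cap t)) (replicate k 0 @ w)"
    unfolding replicate_Suc append_Cons run_Cons trans_unary_code bind.bind_lunit ..
  then show ?case
    unfolding Suc.IH eq by simp
qed simp

definition encode :: "nat list \<Rightarrow> nat list" where
  "encode ys = concat (map (\<lambda>i. replicate i 0 @ [1]) ys)"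

lemma set_encode: "set (encode ys) \<subseteq> {0, 1}"
  by (induction ys) (auto simp: encode_def)

lemma run_encode:
  assumes cap: "\<And>t i. cap t \<le> i \<Longrightarrow> trans A t i = trans A t (cap t)"
  shows "run (unary_code cap A) (t, 0) (encode ys) = map_option (\<lambda>u. (u, 0)) (run A t ys)"
proof (induction ys arbitrary: t)
  case (Cons i ys)
  have "trans A t (min i (cap t)) = trans A t i"
    using cap[of t i] by (auto simp: min_def)
  then have "run (unary_code cap A) (t, 0) (replicate i 0 @ [1] @ encode ys) =
      Option.bind (map_option (\<lambda>u. (u, 0)) (trans A t i))
        (\<lambda>p. run (unary_code cap A) p (encode ys))"
    unfolding run_unary_code_pending by (cases "i = 0") (simp_all add: run_Cons)
  then show ?case
    using Cons by (cases "trans A t i") (auto simp: encode_def run_Cons)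
qed (simp add: encode_def run_Nil)

lemma is_pfa_unary_code:
  assumes "finite (states A)"
    and "\<And>t i u. t \<in> states A \<Longrightarrow> trans A t i = Some u \<Longrightarrow> u \<in> states A"
  shows "is_pfa (unary_code cap A)"
  using assms by (auto simp: is_pfa_def unary_code_def)

lemma card_states_unary_code:
  "finite (states A) \<Longrightarrow> card (states (unary_code cap A)) = (\<Sum>t\<in>states A. Suc (cap t))"
  by (simp add: unary_code_def)

text \<open>\<open>P S v\<close> says that \<open>S\<close> is a configuration of potential \<open>v\<close>. No configuration is a
  singleton. As long as the potential is below \<open>L\<close>, the image of a configuration under a letter of
  \<open>A\<close> defined on it contains a configuration whose potential is larger by at most one. Since a letter of \<open>A\<close> costs
  at least one symbol, \<open>L - v\<close> symbols are needed. The number \<open>i\<close> of zeros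
  read so far is part of the induction, which runs over arbitrary words and not only over encodings;
  it is not capped, so that a single number serves all states of \<open>S\<close>.\<close>

lemma length_ge_of_potential:
  assumes cap: "\<And>t i. cap t \<le> i \<Longrightarrow> trans A t i = trans A t (cap t)"
    and two: "\<And>S v. P S v \<Longrightarrow> \<exists>t\<in>S. \<exists>u\<in>S. t \<noteq> u"
    and step: "\<And>S v i. P S v \<Longrightarrow> v < L \<Longrightarrow> \<forall>t\<in>S. trans A t i \<noteq> None \<Longrightarrow>
      \<exists>S' v'. P S' v' \<and> v' \<le> v + 1 \<and> Some ` S' \<subseteq> (\<lambda>t. trans A t i) ` S"
    and "P S v" "\<forall>t\<in>S. run (unary_code cap A) (t, min i (cap t)) w = Some s"
  shows "L \<le> length w + v"
  using assms(4,5)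
proof (induction w arbitrary: S v i)
  case Nil
  obtain t u where "t \<in> S" "u \<in> S" "t \<noteq> u"
    using two Nil by blast
  moreover have "(r, min i (cap r)) = s" if "r \<in> S" for r
    using Nil that by (simp add: run_Nil)
  ultimately show ?case by blast
next
  case (Cons x w)
  let ?B = "unary_code cap A"
  show ?case
  proof (cases "x = 0")
    case True
    have "run ?B (t, min (Suc i) (cap t)) w = Some s" if "t \<in> S" for t
    proof -
      have "min (Suc (min i (cap t))) (cap t) = min (Suc i) (cap t)" by auto
      then have "trans ?B (t, min i (cap t)) x = Some (t, min (Suc i) (cap t))"
        using True by simp
      then show ?thesis using Cons.prems that by (auto simp: run_Cons)
    qed
    then show ?thesis using Cons.IH[of S v "Suc i"] Cons.prems(1) by simp
  next
    case False
    have tr: "trans ?B (t, min i (cap t)) x = map_option (\<lambda>u. (u, 0)) (trans A t i)" for t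
      using False cap[of t i] by (auto simp: min_def)
    have run: "\<exists>u. trans A t i = Some u \<and> run ?B (u, 0) w = Some s" if "t \<in> S" for t
      using Cons.prems that by (cases "trans A t i") (auto simp: run_Cons tr)
    show ?thesis
    proof (cases "v < L")
      case True
      have "\<forall>t\<in>S. trans A t i \<noteq> None"
        using run by auto
      from step[OF Cons.prems(1) True this]
      obtain S' v' where S': "P S' v'" "v' \<le> v + 1" "Some ` S' \<subseteq> (\<lambda>t. trans A t i) ` S"
        by blast
      have "run ?B (u, min 0 (cap u)) w = Some s" if "u \<in> S'" for u
      proof -
        have "Some u \<in> (\<lambda>t. trans A t i) ` S"
          using S'(3) that by blast
        then obtain t where t: "t \<in> S" "trans A t i = Some u"
          by auto
        then show ?thesis
          using run[OF t(1)] by simp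
      qed
      then show ?thesis using Cons.IH[of S' v' 0] S' by simp
    qed simp
  qed
qed

section \<open>A binary counter on a rotating tape\<close>

text \<open>\<open>Cell q x\<close> is the bit \<open>x\<close> at place \<open>q\<close> of the cycle. Its number as a digit is not part of the
  state; it is determined by \<open>q\<close> and the clock.\<close>

datatype token = Carry bool | Clock nat | Cell nat bool

text \<open>The order of the letters matters for the number of states: the two letters that are
  reserved for clock \<open>m\<close> come first, so that elsewhere the clock can stop counting zeros at \<open>2\<close>;
  the letter that is defined everywhere comes last, so that a sufficiently
  long block of zeros followed by a one always means \<open>reset\<close>.\<close>

abbreviation (input) "inc \<equiv> 0 :: nat"
abbreviation (input) "collapse \<equiv> 1 :: nat"
abbreviation (input) "ripple \<equiv> 2 :: nat"
abbreviation (input) "absorb \<equiv> 3 :: nat"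
abbreviation (input) "skip \<equiv> 4 :: nat"
abbreviation (input) "reset \<equiv> 5 :: nat"

text \<open>The letters \<open>ripple\<close>, \<open>absorb\<close> and \<open>skip\<close> treat a digit: carry and bit both set, only the
  carry set, no carry. At clock \<open>m\<close> the cell at place \<open>0\<close> is not a digit; it fills
  the step in which \<open>inc\<close> starts the next addition. The clock ignores
  \<open>reset\<close> at \<open>m\<close>, because the clock tokens of the full state set have to meet somewhere.\<close>

fun act :: "nat \<Rightarrow> token \<Rightarrow> nat \<Rightarrow> token option" where
  "act m (Carry c) i =
     (if i = inc then (if c then None else Some (Carry True))
      else if i = collapse then (if c then Some (Carry True) else None)
      else if i = ripple then (if c then Some (Carry True) else None)
      else if i = absorb then (if c then Some (Carry False) else None)
      else if i = skip then (if c then None else Some (Carry False))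
      else Some (Carry False))"
| "act m (Clock l) i =
     (if l < m then (if i < ripple then None else Some (Clock (Suc l)))
      else if i = inc then Some (Clock 0)
      else if i = collapse then Some (Carry True)
      else if i < reset then None
      else Some (Clock m))"
| "act m (Cell (Suc q) x) i = Some (Cell q x)"
| "act m (Cell 0 x) i =
     (if i = inc then Some (Cell m x)
      else if i = collapse then Some (Carry True)
      else if i = ripple then (if x then Some (Cell m False) else None)
      else if i = absorb then (if x then None else Some (Cell m True))
      else if i = skip then Some (Cell m x)
      else Some (Cell m False))"

definition tokens :: "nat \<Rightarrow> token set" where
  "tokens m = range Carry \<union> Clock ` {..m} \<union> (\<lambda>(q, x). Cell q x) ` ({..m} \<times> UNIV)"

definition counter :: "nat \<Rightarrow> (token, nat) pfa" where
  "counter m = \<lparr>states = tokens m, alphabet = {..reset}, trans = act m\<rparr>"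

text \<open>At clock \<open>m\<close> a count up to \<open>5\<close> tells all letters apart; a larger \<open>K\<close> adds states one by
  one.\<close>

fun cap :: "nat \<Rightarrow> nat \<Rightarrow> token \<Rightarrow> nat" where
  "cap m K (Carry c) = 5"
| "cap m K (Clock l) = (if l < m then 2 else K)"
| "cap m K (Cell q x) = (if q = 0 then 5 else 0)"

lemma finite_tokens: "finite (tokens m)"
  by (simp add: tokens_def)

lemma act_in_tokens: "t \<in> tokens m \<Longrightarrow> act m t i = Some u \<Longrightarrow> u \<in> tokens m"
  by (cases "(m, t, i)" rule: act.cases) (auto simp: tokens_def split: if_splits)

lemma act_cap: "5 \<le> K \<Longrightarrow> cap m K t \<le> i \<Longrightarrow> act m t i = act m t (cap m K t)"
  by (cases "(m, t, i)" rule: act.cases) (auto split: if_splits)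

lemma sum_cap: "(\<Sum>t\<in>tokens m. Suc (cap m K t)) = 5 * m + 25 + K"
proof -
  have "(\<Sum>t\<in>tokens m. Suc (cap m K t)) =
      (\<Sum>t\<in>range Carry. Suc (cap m K t)) + (\<Sum>t\<in>Clock ` {..m}. Suc (cap m K t)) +
      (\<Sum>t\<in>(\<lambda>(q, x). Cell q x) ` ({..m} \<times> UNIV). Suc (cap m K t))"
    unfolding tokens_def
    by (subst sum.union_disjoint, auto)+
  also have "(\<Sum>t\<in>range Carry. Suc (cap m K t)) = 12"
    by (subst sum.reindex) (auto simp: inj_on_def UNIV_bool)
  also have "(\<Sum>t\<in>Clock ` {..m}. Suc (cap m K t)) = 3 * m + Suc K"
    by (subst sum.reindex) (auto simp: inj_on_def lessThan_Suc_atMost[symmetric])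
  also have "(\<Sum>t\<in>(\<lambda>(q, x). Cell q x) ` ({..m} \<times> UNIV). Suc (cap m K t)) =
      (\<Sum>(q, x)\<in>{..m} \<times> (UNIV :: bool set). if q = 0 then 6 else 1)"
    by (subst sum.reindex) (auto simp: inj_on_def intro!: sum.cong)
  also have "\<dots> = (\<Sum>q\<le>m. 2 * (if q = 0 then 6 else 1))"
    by (simp add: sum.cartesian_product[symmetric])
  also have "\<dots> = 2 * m + 12"
    by (subst sum.atMost_shift) simp
  finally show ?thesis by simp
qed

text \<open>Digit \<open>j\<close> has the value \<open>g j\<close>; digit \<open>l\<close> is the one at place \<open>0\<close>, and the digits follow
  each other around the cycle. Digit \<open>m\<close> is the cell that does not count.\<close>

definition cells :: "nat \<Rightarrow> nat \<Rightarrow> (nat \<Rightarrow> bool) \<Rightarrow> token set" where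
  "cells m l g = (\<lambda>j. Cell (if l \<le> j then j - l else Suc m + j - l) (g j)) ` {..m}"

definition config :: "nat \<Rightarrow> bool \<Rightarrow> nat \<Rightarrow> (nat \<Rightarrow> bool) \<Rightarrow> token set" where
  "config m c l g = {Carry c, Clock l} \<union> cells m l g"

definition bits_value :: "nat \<Rightarrow> (nat \<Rightarrow> bool) \<Rightarrow> nat" where
  "bits_value m g = (\<Sum>j<m. of_bool (g j) * 2 ^ j)"

text \<open>A carry at clock \<open>l\<close> is a pending addition of one to digit \<open>l\<close>. At clock \<open>m\<close> it is an
  overflow.\<close>

definition potential :: "nat \<Rightarrow> bool \<Rightarrow> nat \<Rightarrow> (nat \<Rightarrow> bool) \<Rightarrow> nat" where
  "potential m c l g = bits_value m g + of_bool c * 2 ^ l"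

lemma bits_value_upd:
  "l < m \<Longrightarrow> bits_value m (g(l := x)) + of_bool (g l) * 2 ^ l = bits_value m g + of_bool x * 2 ^ l"
proof -
  assume "l < m"
  then have split: "bits_value m h = of_bool (h l) * 2 ^ l + (\<Sum>j\<in>{..<m} - {l}. of_bool (h j) * 2 ^ j)"
    for h
    unfolding bits_value_def by (intro sum.remove) auto
  have "(\<Sum>j\<in>{..<m} - {l}. of_bool ((g(l := x)) j) * 2 ^ j) =
      (\<Sum>j\<in>{..<m} - {l}. of_bool (g j) * 2 ^ j :: nat)"
    by (rule sum.cong) auto
  then show ?thesis
    using split[of g] split[of "g(l := x)"] by simp
qed

lemma bits_value_upd_last: "bits_value m (g(m := x)) = bits_value m g"
  unfolding bits_value_def by (rule sum.cong) auto

lemma bits_value_less: "bits_value m g < 2 ^ m"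
proof -
  have "bits_value m g \<le> (\<Sum>j<m. 2 ^ j)"
    unfolding bits_value_def by (intro sum_mono) auto
  also have "\<dots> < 2 ^ m"
    by (induction m) auto
  finally show ?thesis .
qed

lemma bits_value_shift:
  "bits_value m (\<lambda>j. if j = m then x else g (Suc j)) \<le> bits_value (Suc m) g"
proof -
  have "bits_value m (\<lambda>j. if j = m then x else g (Suc j)) \<le> (\<Sum>j<m. of_bool (g (Suc j)) * 2 ^ Suc j)"
    unfolding bits_value_def by (intro sum_mono) auto
  also have "\<dots> \<le> bits_value (Suc m) g"
    unfolding bits_value_def sum.lessThan_Suc_shift by simp
  finally show ?thesis .
qed

text \<open>With digits as index, the motion of the cells only amounts to the advance of the clock, and a
  letter changes digit \<open>l\<close> alone.\<close>

lemma rotate_cells: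
  assumes "l \<le> m" "act m (Cell 0 (g l)) i = Some (Cell m x)"
  shows "(\<lambda>t. act m t i) ` cells m l g =
    Some ` cells m (if l = m then 0 else Suc l) (g(l := x))"
  unfolding cells_def image_image
proof (rule image_cong[OF refl])
  fix j assume "j \<in> {..m}"
  then consider "j = l" | d where "j = l + Suc d" "j \<le> m" | "j < l"
    by (metis atMost_iff less_imp_Suc_add add_Suc_right linorder_cases)
  then show "act m (Cell (if l \<le> j then j - l else Suc m + j - l) (g j)) i =
    Some (Cell (if (if l = m then 0 else Suc l) \<le> j then j - (if l = m then 0 else Suc l)
         else Suc m + j - (if l = m then 0 else Suc l)) ((g(l := x)) j))"
  proof cases
    case 3
    then have "Suc m + j - l = Suc (m + j - l)" using assms by simp
    then show ?thesis using 3 assms by auto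
  qed (use assms in auto)
qed

text \<open>This accounts for \<open>reset\<close> at clock \<open>m\<close>: the cells move but the clock stays, so every digit
  becomes its predecessor.\<close>

lemma cells_reindex:
  "cells m 0 g = cells m m (\<lambda>j. if j = m then g 0 else g (Suc j))"
proof (intro set_eqI iffI)
  fix t assume "t \<in> cells m 0 g"
  then obtain j where "j \<le> m" "t = Cell j (g j)" by (auto simp: cells_def)
  then show "t \<in> cells m m (\<lambda>j. if j = m then g 0 else g (Suc j))"
    unfolding cells_def by (cases j) (auto simp: image_iff intro: bexI[of _ m] bexI[of _ "j - 1"])
next
  fix t assume "t \<in> cells m m (\<lambda>j. if j = m then g 0 else g (Suc j))"
  then obtain j where "j \<le> m" "t = (if j = m then Cell 0 (g 0) else Cell (Suc j) (g (Suc j)))"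
    by (auto simp: cells_def split: if_splits)
  then show "t \<in> cells m 0 g"
    unfolding cells_def by (auto simp: image_iff split: if_splits)
qed

lemma step_config:
  assumes "l \<le> m" "act m (Carry c) i = Some (Carry c')" "act m (Clock l) i = Some (Clock l')"
    and "act m (Cell 0 (g l)) i = Some (Cell m x)"
    and "cells m (if l = m then 0 else Suc l) (g(l := x)) = cells m l' g'"
  shows "(\<lambda>t. act m t i) ` config m c l g = Some ` config m c' l' g'"
  using assms(2,3) rotate_cells[where g = g, OF assms(1,4)] assms(5)
  by (simp add: config_def image_Un)

section \<open>The counter cannot be rushed\<close>

text \<open>\<open>ripple\<close>, \<open>absorb\<close> and \<open>skip\<close> preserve the potential, \<open>inc\<close> adds one, and \<open>collapse\<close> is
  possible only after an overflow. \<open>reset\<close> never increases it: before clock \<open>m\<close>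
  it deletes a digit and the carry, and at clock \<open>m\<close> it also shifts the digits down,
  which at least halves the number.\<close>

lemma potential_step:
  assumes m: "0 < m" and l: "l \<le> m" and V: "potential m c l g < 2 ^ m"
    and def: "\<forall>t\<in>config m c l g. act m t i \<noteq> None"
  shows "\<exists>c' l' g'. l' \<le> m \<and> potential m c' l' g' \<le> potential m c l g + 1 \<and>
    Some ` config m c' l' g' = (\<lambda>t. act m t i) ` config m c l g"
proof -
  have cell: "Cell 0 (g l) \<in> config m c l g"
    using l by (auto simp: config_def cells_def image_iff intro: bexI[of _ l])
  have def': "act m (Carry c) i \<noteq> None" "act m (Clock l) i \<noteq> None" "act m (Cell 0 (g l)) i \<noteq> None"
    using def cell by (auto simp: config_def)
  \<comment> \<open>The last condition of the first case says that the bit and the carry that remain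
    represent at most the sum of the old ones; the new carry has twice the weight.\<close>
  consider (advance) x c' where "l < m" "act m (Carry c) i = Some (Carry c')" 
        "act m (Clock l) i = Some (Clock (Suc l))" "act m (Cell 0 (g l)) i = Some (Cell m x)"
        "of_bool x + 2 * of_bool c' \<le> of_bool (g l) + (of_bool c :: nat)"
    | (inc) "l = m" "i = inc" "\<not> c" | (collapse) "l = m" "i = collapse" "c" | (hold) "l = m" "i \<ge> reset"
  proof (cases "l < m")
    case True
    then have "i = ripple \<and> c \<and> g l \<or> i = absorb \<and> c \<and> \<not> g l \<or> i = skip \<and> \<not> c \<or> i \<ge> reset"
      using def' by (auto split: if_splits)
    then show thesis
      using True advance[of True False] advance[of False True] advance[of False "g l"]
        advance[of False False] by auto
  next
    case False
    then show thesis
      using l def' inc collapse hold by (auto split: if_splits)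
  qed
  then show ?thesis
  proof cases
    case advance
    have "(of_bool x + 2 * of_bool c') * 2 ^ l \<le> (of_bool (g l) + of_bool c) * (2 ^ l :: nat)"
      by (intro mult_right_mono advance(5)) simp
    then have "potential m c' (Suc l) (g(l := x)) \<le> potential m c l g"
      using bits_value_upd[OF \<open>l < m\<close>, of g x] by (simp add: potential_def algebra_simps)
    then show ?thesis
      using step_config[where g = g and g' = "g(l := x)", OF l advance(2-4)] advance(1)
      by (intro exI[of _ c'] exI[of _ "Suc l"] exI[of _ "g(l := x)"]) auto
  next
    case inc
    then show ?thesis
      using step_config[where g = g and g' = g and x = "g m", OF l, of c i True 0]
      by (intro exI[of _ True] exI[of _ 0] exI[of _ g]) (auto simp: potential_def)
  next
    case collapse
    then show ?thesis using V by (simp add: potential_def)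
  next
    case hold
    obtain k where k: "m = Suc k" using m by (cases m) auto
    let ?h = "g(m := False)"
    let ?g' = "\<lambda>j. if j = m then ?h 0 else ?h (Suc j)"
    have "bits_value m ?g' = bits_value k (\<lambda>j. if j = k then False else g (Suc j))"
      unfolding k bits_value_def by simp
    also have "\<dots> \<le> bits_value m g"
      using bits_value_shift k by simp
    finally have "potential m False m ?g' \<le> potential m c l g" by (simp add: potential_def)
    moreover have "(\<lambda>t. act m t i) ` config m c l g = Some ` config m False m ?g'"
    proof (rule step_config[where x = False, OF l])
      show "cells m (if l = m then 0 else Suc l) (g(l := False)) = cells m m ?g'"
        using hold(1) cells_reindex[of m ?h] by simp
    qed (use hold in auto)
    ultimately show ?thesis using hold(1)
      by (intro exI[of _ False] exI[of _ m] exI[of _ ?g']) auto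
  qed
qed

lemma synchronizing_word_long:
  assumes "0 < m" "5 \<le> K"
    and sync: "carefully_synchronizing_word (unary_code (cap m K) (counter m)) w"
  shows "2 ^ m \<le> length w"
proof -
  let ?B = "unary_code (cap m K) (counter m)"
  define zero where "zero = (\<lambda>_::nat. False)"
  define P where "P S v \<longleftrightarrow> (\<exists>c l g. l \<le> m \<and> S = config m c l g \<and> v = potential m c l g)" for S v
  have P: "P (config m c l g) (potential m c l g)" if "l \<le> m" for c l g
    using that by (auto simp: P_def)
  obtain s where s: "\<forall>q\<in>states ?B. run ?B q w = Some s"
    using sync by (auto simp: carefully_synchronizing_word_def)
  have "config m False m zero \<subseteq> tokens m"
    by (auto simp: config_def cells_def tokens_def)
  then have "\<forall>t\<in>config m False m zero. (t, min 0 (cap m K t)) \<in> states ?B"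
    by (auto simp: unary_code_def counter_def)
  then have start: "\<forall>t\<in>config m False m zero. run ?B (t, min 0 (cap m K t)) w = Some s"
    using s by blast
  have "2 ^ m \<le> length w + potential m False m zero"
  proof (rule length_ge_of_potential[where P = P and cap = "cap m K" and i = 0,
        OF _ _ _ P[OF order_refl] start])
    show "trans (counter m) t i = trans (counter m) t (cap m K t)" if "cap m K t \<le> i" for t i
      using act_cap[OF assms(2) that] by (simp add: counter_def)
    show "\<exists>t\<in>S. \<exists>u\<in>S. t \<noteq> u" if "P S v" for S v
      using that by (auto simp: P_def config_def)
    show "\<exists>S' v'. P S' v' \<and> v' \<le> v + 1 \<and> Some ` S' \<subseteq> (\<lambda>t. trans (counter m) t i) ` S"
      if "P S v" "v < 2 ^ m" and def: "\<forall>t\<in>S. trans (counter m) t i \<noteq> None" for S v i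
    proof -
      obtain c l g where S: "l \<le> m" "S = config m c l g" "v = potential m c l g"
        using \<open>P S v\<close> by (auto simp: P_def)
      have "\<forall>t\<in>config m c l g. act m t i \<noteq> None"
        using def S(2) by (simp add: counter_def)
      from potential_step[OF assms(1) S(1) _ this]
      obtain c' l' g' where "l' \<le> m" "potential m c' l' g' \<le> v + 1"
        "Some ` config m c' l' g' = (\<lambda>t. act m t i) ` S"
        using S(2,3) \<open>v < 2 ^ m\<close> by blast
      then show ?thesis
        using P[OF \<open>l' \<le> m\<close>, of c' g'] by (intro exI conjI) (auto simp: counter_def)
    qed
  qed
  then show ?thesis by (simp add: potential_def bits_value_def zero_def)
qed

section \<open>The counter can be synchronized\<close>

lemma run_collapse:
  "run (counter m) (Carry True) (replicate k collapse) = Some (Carry True)"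
  "run (counter m) (Clock m) (replicate (Suc k) collapse) = Some (Carry True)"
  "q \<le> k \<Longrightarrow> run (counter m) (Cell q x) (replicate (Suc k) collapse) = Some (Carry True)"
proof -
  show carry: "run (counter m) (Carry True) (replicate k collapse) = Some (Carry True)" for k
    by (induction k) (simp_all add: run_Nil run_Cons counter_def)
  show "run (counter m) (Clock m) (replicate (Suc k) collapse) = Some (Carry True)"
    using carry by (simp add: run_Cons) (simp add: counter_def)
  show "q \<le> k \<Longrightarrow> run (counter m) (Cell q x) (replicate (Suc k) collapse) = Some (Carry True)"
  proof (induction q arbitrary: k)
    case 0
    then show ?case using carry by (simp add: run_Cons) (simp add: counter_def)
  next
    case (Suc q)
    then show ?case by (cases k) (auto simp: run_Cons[of _ "Cell (Suc q) x"] counter_def)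
  qed
qed

text \<open>The potential is below \<open>2 * 2 ^ m\<close>. At each clock before \<open>m\<close> one of the digit letters applies
  and preserves it, and at clock \<open>m\<close> either \<open>inc\<close> increases it or the overflow allows to merge. So the
  pair of potential and clock grows lexicographically until the tokens can be merged.\<close>

lemma config_synchronizable:
  assumes "l \<le> m"
  shows "\<exists>ys. \<forall>t\<in>config m c l g. run (counter m) t ys = Some (Carry True)"
  using assms
proof (induction "(2 * 2 ^ m - potential m c l g, m - l)" arbitrary: c l g
    rule: wf_induct_rule[OF wf_lex_prod[OF wf_less_than wf_less_than]])
  case (1 c l g)
  have V: "potential m c l g < 2 * 2 ^ m"
  proof -
    have "of_bool c * 2 ^ l \<le> (2 ^ m :: nat)" using 1 by (simp add: power_increasing)
    then show ?thesis using bits_value_less[of m g] by (simp add: potential_def)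
  qed
  have continue: ?case
    if "(\<lambda>t. act m t i) ` config m c l g = Some ` config m c' l' g'" "l' \<le> m"
      "potential m c l g < potential m c' l' g' \<or> potential m c l g = potential m c' l' g' \<and> l < l'"
    for i c' l' g'
  proof -
    have "\<exists>ys. \<forall>t\<in>config m c' l' g'. run (counter m) t ys = Some (Carry True)"
      using 1 V that(2,3) by (intro 1(1)) auto
    then obtain ys where ys: "\<forall>t\<in>config m c' l' g'. run (counter m) t ys = Some (Carry True)" ..
    have "run (counter m) t (i # ys) = Some (Carry True)" if "t \<in> config m c l g" for t
    proof -
      have "act m t i \<in> Some ` config m c' l' g'"
        unfolding \<open>_ = Some ` config m c' l' g'\<close>[symmetric] using that by (rule imageI)
      then obtain u where "u \<in> config m c' l' g'" "act m t i = Some u"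
        by auto
      then show ?thesis using ys by (simp add: run_Cons) (simp add: counter_def)
    qed
    then show ?thesis by blast
  qed
  consider "l = m" "c" | "l = m" "\<not> c" | "l < m" "c" "g l" | "l < m" "c" "\<not> g l" | "l < m" "\<not> c"
    using 1 by linarith
  then show ?case
  proof cases
    assume "l = m" "c"
    then have "run (counter m) t (replicate (Suc m) collapse) = Some (Carry True)"
      if "t \<in> config m c l g" for t
      using that run_collapse(1)[of m "Suc m"] run_collapse(2,3)
      by (auto simp: config_def cells_def simp del: replicate_Suc)
    then show ?thesis by blast
  next
    assume *: "l = m" "\<not> c"
    show ?thesis
      by (rule continue[OF step_config[where i = inc and x = "g m" and l' = 0 and c' = True and g' = g]])
         (use * in \<open>auto simp: potential_def\<close>)
  next
    assume *: "l < m" "c" "g l"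
    show ?thesis
      by (rule continue[OF step_config[where i = ripple and x = False and l' = "Suc l" and c' = True
              and g' = "g(l := False)"]])
         (use * bits_value_upd[of l m g False] in \<open>auto simp: potential_def\<close>)
  next
    assume *: "l < m" "c" "\<not> g l"
    show ?thesis
      by (rule continue[OF step_config[where i = absorb and x = True and l' = "Suc l" and c' = False
              and g' = "g(l := True)"]])
         (use * bits_value_upd[of l m g True] in \<open>auto simp: potential_def\<close>)
  next
    assume *: "l < m" "\<not> c"
    show ?thesis
      by (rule continue[OF step_config[where i = skip and x = "g l" and l' = "Suc l" and c' = False
              and g' = g]])
         (use * in \<open>auto simp: potential_def\<close>)
  qed
qed

text \<open>While the cells make one turn, each of them passes place \<open>0\<close> and is cleared, and each clock
  token arrives at \<open>m\<close> and waits there.\<close>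

lemma run_reset:
  assumes "t \<in> tokens m"
  shows "\<exists>u\<in>config m False m (\<lambda>_. False). run (counter m) t (replicate (Suc m) reset) = Some u"
proof -
  let ?run = "\<lambda>k t. run (counter m) t (replicate k reset)"
  have step: "?run (Suc k) t = Option.bind (act m t reset) (?run k)" for k t
    by (simp add: run_Cons) (simp add: counter_def)
  have carry: "?run k (Carry False) = Some (Carry False)" for k
    by (induction k) (simp_all add: run_Nil step del: replicate_Suc)
  have clock: "?run k (Clock l) = Some (Clock (min m (l + k)))" if "l \<le> m" for k l
    using that
    by (induction k arbitrary: l) (auto simp: run_Nil step min_def simp del: replicate_Suc)
  have zero: "\<exists>p\<le>m. ?run k (Cell q False) = Some (Cell p False)" if "q \<le> m" for k q
    using that
  proof (induction k arbitrary: q)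
    case (Suc k)
    then show ?case by (cases q) (auto simp: step simp del: replicate_Suc)
  qed (simp add: run_Nil)
  have cell: "\<exists>p\<le>m. ?run (Suc k) (Cell q x) = Some (Cell p False)" if "q \<le> k" for k q x
    using that
  proof (induction q arbitrary: k)
    case 0
    then show ?case using zero by (simp add: step del: replicate_Suc)
  next
    case (Suc q)
    then obtain k' where "k = Suc k'" "q \<le> k'" by (cases k) auto
    then show ?case
      using Suc.IH by (simp add: step[where t = "Cell (Suc q) x"] del: replicate_Suc)
  qed
  have mem: "Cell p False \<in> config m False m (\<lambda>_. False)" if "p \<le> m" for p
    using that cells_reindex[of m "\<lambda>_. False"] by (auto simp: config_def cells_def)
  from assms consider c where "t = Carry c" | l where "t = Clock l" "l \<le> m"
    | q x where "t = Cell q x" "q \<le> m"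
    by (auto simp: tokens_def)
  then show ?thesis
  proof cases
    case 1
    then show ?thesis
      using carry by (simp add: step config_def del: replicate_Suc)
  next
    case 2
    then show ?thesis
      using clock[of l "Suc m"] by (simp add: config_def del: replicate_Suc)
  next
    case 3
    then obtain p where "p \<le> m" "?run (Suc m) t = Some (Cell p False)"
      using cell by blast
    then show ?thesis
      using mem by blast
  qed
qed

text \<open>In the full state set the tokens have read different numbers of zeros. A block of \<open>K\<close> zeros
  brings all of them to their caps, and after the following one they are in step.\<close>

lemma counter_synchronizable:
  assumes K: "5 \<le> K"
  shows "carefully_synchronizing (unary_code (cap m K) (counter m))"
proof -
  let ?B = "unary_code (cap m K) (counter m)"
  obtain ys where ys: "\<forall>t\<in>config m False m (\<lambda>_. False). run (counter m) t ys = Some (Carry True)"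
    using config_synchronizable by blast
  define zs where "zs = replicate (Suc m) reset @ ys"
  define w where "w = replicate K 0 @ [1] @ encode zs"
  have run: "run ?B (t, i) w = Some (Carry True, 0)" if "t \<in> tokens m" "i \<le> cap m K t" for t i
  proof -
    have le: "cap m K t \<le> K" using K by (cases t) auto
    then have pending: "(if K = 0 then i else min (i + K) (cap m K t)) = cap m K t"
      using K by auto
    have "act m t K \<noteq> None"
      using K by (cases "(m, t, K)" rule: act.cases) auto
    then obtain u where u: "act m t K = Some u"
      by blast
    then have tr: "trans ?B (t, cap m K t) 1 = Some (u, 0)"
      using act_cap[OF K le] by (simp add: counter_def)
    have "run ?B (t, i) w = run ?B (t, cap m K t) ([1] @ encode zs)"
      unfolding w_def run_unary_code_pending pending ..
    also have "\<dots> = run ?B (u, 0) (encode zs)"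
      using tr by (simp add: run_Cons)
    also have "\<dots> = map_option (\<lambda>u. (u, 0)) (run (counter m) u zs)"
    proof (rule run_encode)
      show "trans (counter m) t i = trans (counter m) t (cap m K t)" if "cap m K t \<le> i" for t i
        using act_cap[OF K that] by (simp add: counter_def)
    qed
    also have "run (counter m) u zs = Some (Carry True)"
    proof -
      have "u \<in> tokens m" using u act_in_tokens that by blast
      then obtain v where "v \<in> config m False m (\<lambda>_. False)"
          "run (counter m) u (replicate (Suc m) reset) = Some v"
        using run_reset by blast
      then show ?thesis
        using ys unfolding zs_def run_append by simp
    qed
    finally show ?thesis by simp
  qed
  have states: "states ?B = (SIGMA t:tokens m. {..cap m K t})"
    by (simp add: unary_code_def counter_def)
  have "w \<in> lists (alphabet ?B)"
    using set_encode[of zs] by (auto simp: w_def unary_code_def)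
  moreover have "(Carry True, 0) \<in> states ?B"
    by (simp add: states tokens_def)
  moreover have "\<forall>q\<in>states ?B. run ?B q w = Some (Carry True, 0)"
    using run by (auto simp: states)
  ultimately show ?thesis
    unfolding carefully_synchronizing_def carefully_synchronizing_word_def by blast
qed

section \<open>The lower bound\<close>

theorem theorem9:
  "\<exists>c::real. c > 0 \<and> (\<exists>N::nat. \<forall>n::nat. n \<ge> N \<longrightarrow>
     (\<exists>A :: (nat, nat) pfa.
        is_pfa A \<and> card (states A) = n \<and> card (alphabet A) = 2 \<and>
        carefully_synchronizing A \<and>
        (\<forall>w. carefully_synchronizing_word A w \<longrightarrow>
           real (length w) \<ge> c * golden_ratio powr (real n / 5))))"
proof (intro exI[of _ "golden_ratio powr (- 34 / 5)"] conjI exI[of _ 35] allI impI)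
  have "sqrt 5 \<le> sqrt (3 ^ 2)" by (intro real_sqrt_le_mono) simp
  then have golden: "1 < golden_ratio" "golden_ratio \<le> 2"
    by (auto simp: golden_ratio_def)
  then show "0 < golden_ratio powr (- 34 / 5)" by simp
  fix n :: nat assume n: "35 \<le> n"
  \<comment> \<open>The automaton has \<open>5 * m + 25 + K\<close> states, where \<open>K \<ge> 5\<close>. With \<open>K < 10\<close> this gives
    \<open>n \<le> 5 * m + 34\<close>, whence the constant.\<close>
  define m where "m = (n - 30) div 5"
  define K where "K = 5 + (n - 30) mod 5"
  have m: "0 < m" and K: "5 \<le> K" and mK: "5 * m + 25 + K = n" and n_le: "n \<le> 5 * m + 34"
    using n by (auto simp: m_def K_def)
  define B where "B = unary_code (cap m K) (counter m)"
  have pfa: "is_pfa B"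
    unfolding B_def using finite_tokens act_in_tokens
    by (intro is_pfa_unary_code) (auto simp: counter_def)
  then have "finite (states B)" by (simp add: is_pfa_def)
  then obtain f :: "token \<times> nat \<Rightarrow> nat" where f: "inj_on f (states B)"
    using finite_imp_inj_to_nat_seg[of "states B"] by auto
  let ?A = "rename f B"
  have "card (states B) = n"
    unfolding B_def using mK finite_tokens[of m] sum_cap[of m K]
    by (subst card_states_unary_code) (simp_all only: counter_def pfa.simps)
  then have card: "card (states ?A) = n"
    using f by (simp add: rename_def card_image)
  have "carefully_synchronizing ?A"
    using counter_synchronizable[OF K, of m, folded B_def]
    unfolding carefully_synchronizing_def carefully_synchronizing_word_rename[OF pfa f] .
  moreover have "golden_ratio powr (- 34 / 5) * golden_ratio powr (real n / 5) \<le> real (length w)"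
    if "carefully_synchronizing_word ?A w" for w
  proof -
    have "golden_ratio powr (- 34 / 5) * golden_ratio powr (real n / 5) =
        golden_ratio powr ((real n - 34) / 5)"
      unfolding powr_add[symmetric] by (simp add: field_simps)
    also have "\<dots> \<le> golden_ratio powr (real m)"
      using golden n_le by (intro powr_mono) auto
    also have "\<dots> = golden_ratio ^ m"
      using golden by (simp add: powr_realpow)
    also have "\<dots> \<le> 2 ^ m"
      using golden by (intro power_mono) auto
    also have "\<dots> = real (2 ^ m)"
      by simp
    also have "2 ^ m \<le> length w"
      using that unfolding carefully_synchronizing_word_rename[OF pfa f] unfolding B_def
      by (rule synchronizing_word_long[OF m K])
    finally show ?thesis by simp
  qed
  moreover have "card (alphabet ?A) = 2"
    by (simp add: rename_def B_def unary_code_def)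
  ultimately show "\<exists>A :: (nat, nat) pfa.
        is_pfa A \<and> card (states A) = n \<and> card (alphabet A) = 2 \<and>
        carefully_synchronizing A \<and>
        (\<forall>w. carefully_synchronizing_word A w \<longrightarrow>
           real (length w) \<ge> golden_ratio powr (- 34 / 5) * golden_ratio powr (real n / 5))"
    using is_pfa_rename[OF pfa f] card by (intro exI[of _ ?A] conjI allI impI)
qed

end
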